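(* Let $\omega\in[0,1]$, let $c_w\in(0,1)$, and let $c_{AT},c_c,c_d$ be constants with $c_d+c_{AT}+c_c\le1$ such that $$\|\Delta\mathbf{A}^T\|\,\|\mathbf{y}_o\|\le c_{AT}\|\mathbf{r}_d(\mathbf{q}_c)\|,\qquad \|\Delta\mathbf{c}\|\le c_c\|\mathbf{r}_d(\mathbf{q}_c)\|,\qquad \|\mathbf{r}^o_d(\mathbf{q}_o)\|\le c_d\|\mathbf{r}_d(\mathbf{q}_c)\| .$$ If $c_w\ge 1-\omega(1-c_d-c_{AT}-c_c)$, then the warm starting point $\mathbf{q}_w$ satisfies $$\|\mathbf{r}_d(\mathbf{q}_w)\|\le c_w\|\mathbf{r}_d(\mathbf{q}_c)\| .$$
   Context: Norms are Euclidean (spectral norm for matrices). $\mathcal{K}=\mathcal{K}^1\times\cdots\times\mathcal{K}^k\subset\mathbb{R}^n$ is a product of $k$ second-order cones $\{\mathbf{v}\in\mathbb{R}^{n_i}:\mathbf{v}_1\ge\|\mathbf{v}_{2:n_i}\|\}$ (equal to $[0,\infty)$ if $n_i=1$), and $\mathbf{e}=(\mathbf{e}^{(1)},\dots,\mathbf{e}^{(k)})$ with $\mathbf{e}^{(i)}=(1,0,\dots,0)^T\in\mathbb{R}^{n_i}$. Two second-order cone programs "minimize $\mathbf{c}^T\mathbf{x}$ subject to $\mathbf{A}\mathbf{x}=\mathbf{b}$, $\mathbf{x}\in\mathcal{K}$" with the same dimensions and cones are considered: the current problem, with data $\mathbf{A}\in\mathbb{R}^{p\times n},\mathbf{b}\in\mathbb{R}^p,\mathbf{c}\in\mathbb{R}^n$,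 and a previous problem, with data $\mathbf{A}_o,\mathbf{b}_o,\mathbf{c}_o$. Put $\Delta\mathbf{A}=\mathbf{A}-\mathbf{A}_o$, $\Delta\mathbf{b}=\mathbf{b}-\mathbf{b}_o$, $\Delta\mathbf{c}=\mathbf{c}-\mathbf{c}_o$. Let $\mathbf{q}_o=(\mathbf{x}_o,\mathbf{y}_o,\mathbf{s}_o)$, with $\mathbf{x}_o,\mathbf{s}_o\in\mathcal{K}$, $\mathbf{y}_o\in\mathbb{R}^p$, be an inexact solution of the previous problem and its dual (only approximately satisfying the equality constraints). For a point $\mathbf{q}=(\mathbf{x},\mathbf{y},\mathbf{s},\kappa,\tau)$ the dual residual of the current problem is $\mathbf{r}_d(\mathbf{q})=\mathbf{A}^T\mathbf{y}+\mathbf{s}-\tau\mathbf{c}$; the dual residual of the previous problem at $\mathbf{q}_o$ (with $\tau=1$) is $\mathbf{r}_d^o(\mathbf{q}_o)=\mathbf{A}_o^T\mathbf{y}_o+\mathbf{s}_o-\mathbf{c}_o$. The cold starting point is $\mathbf{q}_c=(\mathbf{e},0,\mathbf{e},1,1)$. The warm starting point $\mathbf{q}_w=(\mathbf{x}_w,\mathbf{y}_w,\mathbf{s}_w,\kappa_w,\tau_w)$ is $\mathbf{x}_w=\omega\mathbf{x}_o+(1-\omega)\mathbf{e}$, $\mathbf{y}_w=\omega\mathbf{y}_o$, $\mathbf{s}_w=\omega\mathbf{s}_o+(1-\omega)\mathbf{e}$, $\kappa_w=\mathbf{x}_w^T\mathbf{s}_w/k$, $\tau_w=1$. *)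

theory Defs
  imports "HOL-Analysis.Analysis"
begin

text \<open>
  The coordinates of $R^n$ are labelled by a finite type \<open>'n\<close> and the \<open>k\<close> cones by a finite
  type \<open>'k\<close>. The splitting of \<open>n\<close> into \<open>n\<^sub>1, \<dots>, n\<^sub>k\<close> is given by \<open>blk\<close>, which sends a coordinate
  to the block containing it, and \<open>lead\<close>, which selects the first coordinate of every block;
  \<open>n\<^sub>i\<close> is the cardinality of the fibre of \<open>blk\<close> over \<open>i\<close>. Nothing depends on how the coordinates
  are ordered, so blocks need not be contiguous.
\<close>

definition block_structure :: "('n::finite \<Rightarrow> 'k::finite) \<Rightarrow> ('k \<Rightarrow> 'n) \<Rightarrow> bool" where
  "block_structure blk lead \<longleftrightarrow> (\<forall>i. blk (lead i) = i)"

text \<open>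
  \<open>L2_set f {} = 0\<close>, so a block with a single coordinate contributes the half-line of
  nonnegative reals.
\<close>

definition soc_product :: "('n::finite \<Rightarrow> 'k::finite) \<Rightarrow> ('k \<Rightarrow> 'n) \<Rightarrow> (real ^ 'n) set" where
  "soc_product blk lead =
     {v. \<forall>i. v $ lead i \<ge> L2_set (\<lambda>j. v $ j) {j. blk j = i \<and> j \<noteq> lead i}}"

definition soc_unit :: "('k::finite \<Rightarrow> 'n::finite) \<Rightarrow> real ^ 'n" where
  "soc_unit lead = (\<chi> j. if j \<in> range lead then 1 else 0)"

text \<open>Data of: minimize \<open>cost \<bullet> x\<close> subject to \<open>mat_A *v x = rhs\<close> and \<open>x\<close> in the cone.\<close>

record ('p, 'n) socp =
  mat_A :: "real ^ 'n ^ 'p"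
  rhs :: "real ^ 'p"
  cost :: "real ^ 'n"

text \<open>A primal-dual point \<open>(x, y, s)\<close>, and a point \<open>(x, y, s, \<kappa>, \<tau>)\<close> of the homogeneous model.\<close>

type_synonym ('p, 'n) pd_point = "(real ^ 'n) \<times> (real ^ 'p) \<times> (real ^ 'n)"
type_synonym ('p, 'n) hom_point =
  "(real ^ 'n) \<times> (real ^ 'p) \<times> (real ^ 'n) \<times> real \<times> real"

fun hom_dual_residual ::
  "('p::finite, 'n::finite) socp \<Rightarrow> ('p, 'n) hom_point \<Rightarrow> real ^ 'n" where
  "hom_dual_residual P (x, y, s, \<kappa>, \<tau>) = transpose (mat_A P) *v y + s - \<tau> *\<^sub>R cost P"

fun dual_residual ::
  "('p::finite, 'n::finite) socp \<Rightarrow> ('p, 'n) pd_point \<Rightarrow> real ^ 'n" where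
  "dual_residual P (x, y, s) = transpose (mat_A P) *v y + s - cost P"

definition cold_start :: "('k::finite \<Rightarrow> 'n::finite) \<Rightarrow> ('p::finite, 'n) hom_point" where
  "cold_start lead = (soc_unit lead, 0, soc_unit lead, 1, 1)"

fun warm_start ::
  "('k::finite \<Rightarrow> 'n::finite) \<Rightarrow> real \<Rightarrow> ('p::finite, 'n) pd_point \<Rightarrow> ('p, 'n) hom_point" where
  "warm_start lead \<omega> (x\<^sub>o, y\<^sub>o, s\<^sub>o) =
     (let x = \<omega> *\<^sub>R x\<^sub>o + (1 - \<omega>) *\<^sub>R soc_unit lead;
          y = \<omega> *\<^sub>R y\<^sub>o;
          s = \<omega> *\<^sub>R s\<^sub>o + (1 - \<omega>) *\<^sub>R soc_unit lead
      in (x, y, s, (x \<bullet> s) / real CARD('k), 1))"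

definition spectral_norm :: "real ^ 'n::finite ^ 'm::finite \<Rightarrow> real" where
  "spectral_norm M = onorm (\<lambda>v. M *v v)"

end

theory Submission
  imports Defs
begin

text \<open>
  The dual residual of the homogeneous model is linear in \<open>(y, s, \<tau>)\<close>, and on these coordinates
  the warm start is the convex combination of the previous point (with \<open>\<tau> = 1\<close>) and the cold
  start, with weights \<open>\<omega>\<close> and \<open>1 - \<omega>\<close>. Evaluating the current residual at the previous point
  amounts to perturbing the previous residual by \<open>\<Delta>A\<^sup>T y\<^sub>o - \<Delta>c\<close>, so writing \<open>R\<close> for the norm of
  the cold residual, the three smallness hypotheses bound it by \<open>(c\<^sub>d + c\<^sub>A\<^sub>T + c\<^sub>c) R\<close>. Convexity
  of the norm then gives \<open>(\<omega> (c\<^sub>d + c\<^sub>A\<^sub>T + c\<^sub>c) + (1 - \<omega>)) R\<close>, and this factor is precisely the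
  lower bound imposed on \<open>c\<^sub>w\<close>.
\<close>

lemma norm_matrix_vector_mult_le_spectral_norm:
  fixes M :: "real ^ 'n::finite ^ 'm::finite"
  shows "norm (M *v v) \<le> spectral_norm M * norm v"
  unfolding spectral_norm_def
  by (rule onorm[OF matrix_vector_mul_bounded_linear])

text \<open>
  Both points have \<open>\<tau> = 1\<close>, so the cost enters once with each weight and the weights sum to 1;
  the cold start has \<open>y = 0\<close>, which is why scaling \<open>y\<close> by \<open>\<omega>\<close> alone is the convex combination.
\<close>

lemma hom_dual_residual_warm_start:
  "hom_dual_residual P (warm_start lead \<omega> (x, y, s)) =
     \<omega> *\<^sub>R dual_residual P (x, y, s) + (1 - \<omega>) *\<^sub>R hom_dual_residual P (cold_start lead)"
  by (simp add: cold_start_def Let_def matrix_vector_mult_scaleR algebra_simps)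

lemma dual_residual_perturb:
  "dual_residual P (x, y, s) =
     dual_residual P' (x, y, s) + transpose (mat_A P - mat_A P') *v y - (cost P - cost P')"
proof -
  have "transpose (mat_A P - mat_A P') = transpose (mat_A P) - transpose (mat_A P')"
    by (simp add: transpose_def vec_eq_iff)
  then show ?thesis
    by (simp add: matrix_vector_mult_diff_rdistrib)
qed

lemma norm_dual_residual_perturb_le:
  "norm (dual_residual P (x, y, s)) \<le>
     norm (dual_residual P' (x, y, s))
     + spectral_norm (transpose (mat_A P - mat_A P')) * norm y
     + norm (cost P - cost P')"
  unfolding dual_residual_perturb[of P x y s P']
  using norm_triangle_ineq4[of "dual_residual P' (x, y, s) + transpose (mat_A P - mat_A P') *v y"
      "cost P - cost P'"]
    norm_triangle_ineq[of "dual_residual P' (x, y, s)" "transpose (mat_A P - mat_A P') *v y"]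
    norm_matrix_vector_mult_le_spectral_norm[of "transpose (mat_A P - mat_A P')" y]
  by linarith

theorem mainTheorem4:
  fixes blk :: "'n::finite \<Rightarrow> 'k::finite" and lead :: "'k \<Rightarrow> 'n"
    and P P\<^sub>o :: "('p::finite, 'n) socp"
    and x\<^sub>o s\<^sub>o :: "real ^ 'n" and y\<^sub>o :: "real ^ 'p"
    and \<omega> c\<^sub>w c\<^sub>A\<^sub>T c\<^sub>c c\<^sub>d :: real
  assumes "block_structure blk lead"
    and "x\<^sub>o \<in> soc_product blk lead" and "s\<^sub>o \<in> soc_product blk lead"
    and "0 \<le> \<omega>" and "\<omega> \<le> 1"
    and "0 < c\<^sub>w" and "c\<^sub>w < 1"
    and "c\<^sub>d + c\<^sub>A\<^sub>T + c\<^sub>c \<le> 1"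
    and "spectral_norm (transpose (mat_A P - mat_A P\<^sub>o)) * norm y\<^sub>o
           \<le> c\<^sub>A\<^sub>T * norm (hom_dual_residual P (cold_start lead))"
    and "norm (cost P - cost P\<^sub>o) \<le> c\<^sub>c * norm (hom_dual_residual P (cold_start lead))"
    and "norm (dual_residual P\<^sub>o (x\<^sub>o, y\<^sub>o, s\<^sub>o))
           \<le> c\<^sub>d * norm (hom_dual_residual P (cold_start lead))"
    and "c\<^sub>w \<ge> 1 - \<omega> * (1 - c\<^sub>d - c\<^sub>A\<^sub>T - c\<^sub>c)"
  shows "norm (hom_dual_residual P (warm_start lead \<omega> (x\<^sub>o, y\<^sub>o, s\<^sub>o)))
           \<le> c\<^sub>w * norm (hom_dual_residual P (cold_start lead))"
proof -
  define r where "r = hom_dual_residual P (cold_start lead)"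
  define d where "d = dual_residual P (x\<^sub>o, y\<^sub>o, s\<^sub>o)"
  have d: "norm d \<le> (c\<^sub>d + c\<^sub>A\<^sub>T + c\<^sub>c) * norm r"
    using norm_dual_residual_perturb_le[of P x\<^sub>o y\<^sub>o s\<^sub>o P\<^sub>o] assms(9-11)
    unfolding r_def d_def by (simp only: distrib_right)
  have "norm (\<omega> *\<^sub>R d + (1 - \<omega>) *\<^sub>R r) \<le> \<omega> * norm d + (1 - \<omega>) * norm r"
    using norm_triangle_ineq[of "\<omega> *\<^sub>R d" "(1 - \<omega>) *\<^sub>R r"] \<open>0 \<le> \<omega>\<close> \<open>\<omega> \<le> 1\<close> by simp
  also have "\<dots> \<le> \<omega> * ((c\<^sub>d + c\<^sub>A\<^sub>T + c\<^sub>c) * norm r) + (1 - \<omega>) * norm r"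
    using mult_left_mono[OF d \<open>0 \<le> \<omega>\<close>] by simp
  also have "\<dots> = (1 - \<omega> * (1 - c\<^sub>d - c\<^sub>A\<^sub>T - c\<^sub>c)) * norm r"
    by (simp add: algebra_simps)
  also have "\<dots> \<le> c\<^sub>w * norm r"
    using assms(12) by (intro mult_right_mono) auto
  finally show ?thesis
    unfolding hom_dual_residual_warm_start r_def d_def .
qed

end
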